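(* Let $p\in(1,\infty)$. Then for every finite metric space $(X,d_X)$ we have $$c_{(\mathscr{P}_p(\mathbb{R}^3),\mathsf{W}_p)}\big(X,d_X^{1/p}\big)=1.$$ (That is, for every $\varepsilon>0$ the metric space $(X,d_X^{1/p})$ embeds into $(\mathscr{P}_p(\mathbb{R}^3),\mathsf{W}_p)$ with distortion at most $1+\varepsilon$.)
   Context: $\mathbb{R}^3$ carries the Euclidean metric. For a complete separable metric space $(Y,d_Y)$ and $p\ge 1$, $\mathscr{P}_p(Y)$ is the set of Borel probability measures $\mu$ on $Y$ with $\int_Y d_Y(y,y_0)^p\,d\mu(y)<\infty$ for some (hence all) $y_0\in Y$, equipped with the Wasserstein metric $\mathsf{W}_p(\mu,\nu)=\inf_{\pi\in\Pi(\mu,\nu)}\big(\iint_{Y\times Y} d_Y(x,y)^p\,d\pi(x,y)\big)^{1/p}$, where $\Pi(\mu,\nu)$ is the set of couplings of $\mu$ and $\nu$ (Borel probability measures on $Y\times Y$ with marginals $\mu,\nu$). Distortion: a map $f:X\to Y$ between metric spaces has distortion at most $D\in[1,\infty]$ if there is $s\in(0,\infty)$ with $s\,d_X(x,y)\le d_Y(f(x),f(y))\le Ds\,d_X(x,y)$ for all $x,y\in X$. $c_{(Y,d_Y)}(X,d_X)$ is the infimum of those $D$ for which some map $f:X\to Y$ has distortion at most $D$. Metric spaces are nonempty. *)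

theory Defs
  imports "HOL-Probability.Probability"
begin

definition wasserstein_space :: "real \<Rightarrow> 'a::polish_space measure set" where
  "wasserstein_space p =
     {\<mu>. prob_space \<mu> \<and> sets \<mu> = sets borel \<and> (\<exists>y0. integrable \<mu> (\<lambda>y. dist y y0 powr p))}"

definition couplings :: "'a::polish_space measure \<Rightarrow> 'a measure \<Rightarrow> ('a \<times> 'a) measure set" where
  "couplings \<mu> \<nu> =
     {\<pi>. prob_space \<pi> \<and> sets \<pi> = sets borel \<and> distr \<pi> borel fst = \<mu> \<and> distr \<pi> borel snd = \<nu>}"

text \<open>Meaningful for \<open>p \<ge> 1\<close> and \<open>\<mu>, \<nu> \<in> wasserstein_space p\<close>: then couplings exist and the cost is
  integrable under each of them (lemmas \<open>couplings_nonempty\<close> and \<open>integrable_coupling_cost\<close> below),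
  so neither the Bochner integral nor the real infimum takes a default value.\<close>

definition wasserstein_dist :: "real \<Rightarrow> 'a::polish_space measure \<Rightarrow> 'a measure \<Rightarrow> real" where
  "wasserstein_dist p \<mu> \<nu> =
     (INF \<pi>\<in>couplings \<mu> \<nu>. (\<integral>z. dist (fst z) (snd z) powr p \<partial>\<pi>) powr (1 / p))"

text \<open>The distortion bound \<open>D\<close> may be \<open>\<infinity>\<close>; in \<^typ>\<open>ereal\<close> the product \<open>\<infinity> * 0\<close> is \<open>0\<close>, so the case
  \<open>x = y\<close> imposes no unwanted condition.\<close>

definition distortion_at_most ::
  "'a set \<Rightarrow> ('a \<Rightarrow> 'a \<Rightarrow> real) \<Rightarrow> ('b \<Rightarrow> 'b \<Rightarrow> real) \<Rightarrow> ('a \<Rightarrow> 'b) \<Rightarrow> ereal \<Rightarrow> bool" where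
  "distortion_at_most X dX dY f D \<longleftrightarrow>
     (\<exists>s::real. s > 0 \<and> (\<forall>x\<in>X. \<forall>y\<in>X.
        ereal (s * dX x y) \<le> ereal (dY (f x) (f y)) \<and>
        ereal (dY (f x) (f y)) \<le> D * ereal (s * dX x y)))"

definition least_distortion ::
  "'b set \<Rightarrow> ('b \<Rightarrow> 'b \<Rightarrow> real) \<Rightarrow> 'a set \<Rightarrow> ('a \<Rightarrow> 'a \<Rightarrow> real) \<Rightarrow> ereal" where
  "least_distortion Y dY X dX =
     Inf {D. 1 \<le> D \<and> (\<exists>f. f \<in> X \<rightarrow> Y \<and> distortion_at_most X dX dY f D)}"

lemma couplings_nonempty:
  fixes \<mu> \<nu> :: "'a::polish_space measure"
  assumes "\<mu> \<in> wasserstein_space p" "\<nu> \<in> wasserstein_space p"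
  shows "couplings \<mu> \<nu> \<noteq> {}"
proof -
  interpret M: prob_space \<mu> using assms by (auto simp: wasserstein_space_def)
  interpret N: prob_space \<nu> using assms by (auto simp: wasserstein_space_def)
  interpret P: pair_prob_space \<mu> \<nu> ..
  have s: "sets \<mu> = sets borel" "sets \<nu> = sets borel"
    using assms by (auto simp: wasserstein_space_def)
  have sp: "sets (\<mu> \<Otimes>\<^sub>M \<nu>) = sets borel"
    using sets_pair_measure_cong[OF s] unfolding borel_prod .
  have "distr (\<mu> \<Otimes>\<^sub>M \<nu>) borel fst = distr (\<mu> \<Otimes>\<^sub>M \<nu>) \<mu> fst"
    by (rule distr_cong) (auto simp: s)
  also have "\<dots> = \<mu>" by (simp add: N.distr_pair_fst N.emeasure_space_1)
  finally have 1: "distr (\<mu> \<Otimes>\<^sub>M \<nu>) borel fst = \<mu>" .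
  have "distr (\<mu> \<Otimes>\<^sub>M \<nu>) borel snd = \<nu>"
  proof (rule measure_eqI)
    fix A assume A: "A \<in> sets (distr (\<mu> \<Otimes>\<^sub>M \<nu>) borel snd)"
    have m: "snd \<in> measurable (\<mu> \<Otimes>\<^sub>M \<nu>) borel"
      using measurable_snd s(2) measurable_cong_sets by blast
    have "snd -` A \<inter> space (\<mu> \<Otimes>\<^sub>M \<nu>) = space \<mu> \<times> A"
      using A s sets.sets_into_space[of A \<nu>] by (auto simp: space_pair_measure)
    moreover have "emeasure (\<mu> \<Otimes>\<^sub>M \<nu>) (space \<mu> \<times> A) = emeasure \<mu> (space \<mu>) * emeasure \<nu> A"
      by (rule N.emeasure_pair_measure_Times) (use A s(2) in simp_all)
    ultimately show "emeasure (distr (\<mu> \<Otimes>\<^sub>M \<nu>) borel snd) A = emeasure \<nu> A"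
      using A m by (simp add: emeasure_distr M.emeasure_space_1)
  qed (simp add: s)
  then have "\<mu> \<Otimes>\<^sub>M \<nu> \<in> couplings \<mu> \<nu>"
    using 1 sp P.prob_space_axioms by (simp add: couplings_def)
  then show ?thesis by blast
qed

lemma dist_powr_le:
  fixes x y z :: "'a::metric_space"
  assumes "p \<ge> 0"
  shows "dist x y powr p \<le> 2 powr p * (dist x z powr p + dist y z powr p)"
proof -
  have "dist x y \<le> 2 * max (dist x z) (dist y z)"
    using dist_triangle2[of x y z] by linarith
  then have "dist x y powr p \<le> (2 * max (dist x z) (dist y z)) powr p"
    using assms by (intro powr_mono2) auto
  also have "\<dots> = 2 powr p * max (dist x z) (dist y z) powr p"
    by (subst powr_mult) auto
  also have "\<dots> \<le> 2 powr p * (dist x z powr p + dist y z powr p)"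
    by (intro mult_left_mono) (auto simp: max_def)
  finally show ?thesis .
qed

lemma integrable_moment:
  fixes \<mu> :: "'a::polish_space measure"
  assumes "\<mu> \<in> wasserstein_space p" "p \<ge> 0"
  shows "integrable \<mu> (\<lambda>y. dist y z powr p)"
proof -
  interpret prob_space \<mu> using assms by (auto simp: wasserstein_space_def)
  have [measurable_cong]: "sets \<mu> = sets borel" using assms by (auto simp: wasserstein_space_def)
  obtain y0 where "integrable \<mu> (\<lambda>y. dist y y0 powr p)"
    using assms by (auto simp: wasserstein_space_def)
  then have "integrable \<mu> (\<lambda>y. 2 powr p * (dist y y0 powr p + dist z y0 powr p))"
    by simp
  then show ?thesis
  proof (rule Bochner_Integration.integrable_bound)
    show "(\<lambda>y. dist y z powr p) \<in> borel_measurable \<mu>"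
      by measurable
    show "AE y in \<mu>. norm (dist y z powr p) \<le> norm (2 powr p * (dist y y0 powr p + dist z y0 powr p))"
    proof (rule AE_I2)
      fix y
      show "norm (dist y z powr p) \<le> norm (2 powr p * (dist y y0 powr p + dist z y0 powr p))"
        using dist_powr_le[OF assms(2), of y z y0] by simp
    qed
  qed
qed

lemma integrable_coupling_cost:
  fixes \<mu> \<nu> :: "'a::polish_space measure"
  assumes "\<mu> \<in> wasserstein_space p" "\<nu> \<in> wasserstein_space p" "p \<ge> 0" "\<pi> \<in> couplings \<mu> \<nu>"
  shows "integrable \<pi> (\<lambda>z. dist (fst z) (snd z) powr p)"
proof -
  define a :: 'a where "a = undefined"
  have "sets \<pi> = sets borel"
    and d: "distr \<pi> borel fst = \<mu>" "distr \<pi> borel snd = \<nu>"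
    using assms(4) by (simp_all add: couplings_def)
  then have s [measurable_cong]: "sets \<pi> = sets (borel \<Otimes>\<^sub>M borel)"
    unfolding borel_prod by simp
  have "integrable (distr \<pi> borel fst) (\<lambda>y. dist y a powr p)"
    unfolding d by (rule integrable_moment[OF assms(1,3)])
  then have 1: "integrable \<pi> (\<lambda>z. dist (fst z) a powr p)"
    by (subst (asm) integrable_distr_eq) measurable
  have "integrable (distr \<pi> borel snd) (\<lambda>y. dist y a powr p)"
    unfolding d by (rule integrable_moment[OF assms(2,3)])
  then have 2: "integrable \<pi> (\<lambda>z. dist (snd z) a powr p)"
    by (subst (asm) integrable_distr_eq) measurable
  have "integrable \<pi> (\<lambda>z. 2 powr p * (dist (fst z) a powr p + dist (snd z) a powr p))"
    by (intro integrable_mult_right Bochner_Integration.integrable_add 1 2)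
  then show ?thesis
  proof (rule Bochner_Integration.integrable_bound)
    show "(\<lambda>z. dist (fst z) (snd z) powr p) \<in> borel_measurable \<pi>"
      by measurable
    show "AE z in \<pi>. norm (dist (fst z) (snd z) powr p)
        \<le> norm (2 powr p * (dist (fst z) a powr p + dist (snd z) a powr p))"
    proof (rule AE_I2)
      fix z
      show "norm (dist (fst z) (snd z) powr p)
        \<le> norm (2 powr p * (dist (fst z) a powr p + dist (snd z) a powr p))"
        using dist_powr_le[OF assms(3), of "fst z" "snd z" a] by simp
    qed
  qed
qed

end

theory Submission
  imports Defs
begin

text \<open>
  Let all measures be uniform on a common finite background \<open>Z\<close> plus one more atom at a point \<open>v x\<close>. To
  transport the measure of \<open>x\<close> to that of \<open>y\<close>, the extra atom can be handed on along a path
  through the background, so the \<open>p\<close>-th power of the Wasserstein distance is, up to the mass of an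
  atom, at most the length of that path when a step of Euclidean length \<open>l\<close> counts \<open>l\<^sup>p\<close>
  (\<open>wasserstein_dist_le_path_cost\<close>). It is at least \<open>\<phi> (v y) - \<phi> (v x)\<close> for every potential
  \<open>\<phi>\<close> with \<open>\<phi> b - \<phi> a \<le> (dist a b)\<^sup>p\<close> on the atoms (\<open>wasserstein_dist_ge_potential_gap\<close>). So it
  suffices to realise a multiple of the given metric, up to a factor close to \<open>1\<close>, as such a path metric
  on a finite set of points of \<open>\<real>\<^sup>3\<close>.

  Since \<open>p > 1\<close>, dividing a segment into \<open>m\<close> equal steps multiplies its cost by \<open>m\<^bsup>1 - p\<^esup>\<close>. Thus the
  cost of each segment can be tuned at will by the number of its steps, provided that it is small
  (\<open>eventually_chain_cost_between\<close>). In \<open>\<real>\<^sup>3\<close> there is room for the complete graph: the segments between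
  points of the moment curve meet only in common endpoints. Divide the segment of \<open>x\<close> and \<open>y\<close>
  such that its cost is about \<open>s * d x y\<close>. When \<open>s\<close> is small, leaving a segment away from its ends is
  too expensive to pay off, since distinct segments are a fixed distance apart there.

  Shortcuts near the vertices remain; they can save only a small part of a segment. To see this, the
  potential is the interpolation of \<open>u \<mapsto> d x u\<close> along the segments that is constant near the vertices.
  There the shortcuts gain nothing, and elsewhere the slope grows only by a factor close to \<open>1\<close>
  (\<open>edge_value_eq_if_close\<close>, \<open>ex_chain_background_in_R3\<close>).
\<close>

section \<open>Transport between finitely supported laws\<close>

text \<open>
  The law of a \<^typ>\<open>'a pmf\<close> is a measure on the power set; Wasserstein spaces want a measure whose
  \<open>\<sigma>\<close>-algebra is exactly the Borel one. Products get their Borel structure from the topology, hence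
  the class \<^class>\<open>topological_space\<close>: pairs of points of a Polish space are covered as well.
\<close>

definition borel_law :: "'a::topological_space pmf \<Rightarrow> 'a measure" where
  "borel_law q = distr (measure_pmf q) borel (\<lambda>x. x)"

lemma sets_borel_law [simp, measurable_cong]: "sets (borel_law q) = sets borel"
  by (simp add: borel_law_def)

lemma prob_space_borel_law: "prob_space (borel_law q)"
  unfolding borel_law_def by (rule measure_pmf.prob_space_distr) simp

lemma integrable_borel_law_finite:
  fixes f :: "'a::topological_space \<Rightarrow> real"
  assumes "finite (set_pmf q)" "f \<in> borel_measurable borel"
  shows "integrable (borel_law q) f"
  unfolding borel_law_def
  by (subst integrable_distr_eq) (use assms in \<open>auto intro: integrable_measure_pmf_finite\<close>)

lemma integral_borel_law:
  fixes f :: "'a::topological_space \<Rightarrow> real"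
  assumes "f \<in> borel_measurable borel"
  shows "(\<integral>x. f x \<partial>borel_law q) = (\<integral>x. f x \<partial>measure_pmf q)"
  unfolding borel_law_def by (subst integral_distr) (use assms in auto)

lemma distr_borel_law:
  fixes f :: "'a::topological_space \<Rightarrow> 'b::topological_space"
  assumes "f \<in> borel_measurable borel"
  shows "distr (borel_law q) borel f = borel_law (map_pmf f q)"
  using assms
  by (simp add: borel_law_def map_pmf_rep_eq distr_distr o_def)

lemma borel_law_in_wasserstein_space:
  fixes q :: "'a::polish_space pmf"
  assumes "finite (set_pmf q)"
  shows "borel_law q \<in> wasserstein_space p"
proof -
  have "integrable (borel_law q) (\<lambda>y. dist y undefined powr p)"
    by (rule integrable_borel_law_finite[OF assms]) measurable
  then show ?thesis
    by (auto simp: wasserstein_space_def prob_space_borel_law)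
qed

lemma measurable_fst_borel [measurable]:
   "fst \<in> borel_measurable (borel :: ('a::second_countable_topology \<times> 'b::second_countable_topology) measure)"
  by (intro borel_measurable_continuous_onI continuous_intros)

lemma measurable_snd_borel [measurable]:
   "snd \<in> borel_measurable (borel :: ('a::second_countable_topology \<times> 'b::second_countable_topology) measure)"
  by (intro borel_measurable_continuous_onI continuous_intros)

lemma wasserstein_dist_le_coupling:
  fixes r :: "('a::polish_space \<times> 'a) pmf"
  shows "wasserstein_dist p (borel_law (map_pmf fst r)) (borel_law (map_pmf snd r))
     \<le> (\<integral>z. dist (fst z) (snd z) powr p \<partial>measure_pmf r) powr (1 / p)"
proof -
  have "borel_law r \<in> couplings (borel_law (map_pmf fst r)) (borel_law (map_pmf snd r))"
    by (auto simp: couplings_def prob_space_borel_law distr_borel_law)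
  then have "wasserstein_dist p (borel_law (map_pmf fst r)) (borel_law (map_pmf snd r))
     \<le> (\<integral>z. dist (fst z) (snd z) powr p \<partial>borel_law r) powr (1 / p)"
    unfolding wasserstein_dist_def
    by (intro cINF_lower) (auto intro!: bdd_belowI2[where m = 0])
  also have "(\<integral>z. dist (fst z) (snd z) powr p \<partial>borel_law r) =
     (\<integral>z. dist (fst z) (snd z) powr p \<partial>measure_pmf r)"
    by (rule integral_borel_law) measurable
  finally show ?thesis .
qed

lemma AE_borel_law_support:
  fixes q :: "'a::t1_space pmf"
  assumes "finite S" "set_pmf q \<subseteq> S"
  shows "AE x in borel_law q. x \<in> S"
  unfolding borel_law_def
  by (subst AE_distr_iff) (use assms in \<open>auto simp: AE_measure_pmf_iff borel_closed finite_imp_closed\<close>)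

text \<open>
  The easy half of Kantorovich duality: any coupling transports from the support of the one law to the
  support of the other, so there its cost dominates \<open>\<phi> (snd z) - \<phi> (fst z)\<close>, whose integral depends on
  the marginals only.
\<close>

lemma wasserstein_dist_ge_potential:
  fixes q q' :: "'a::polish_space pmf"
  assumes p: "0 < p" and fin: "finite S" and supp: "set_pmf q \<subseteq> S" "set_pmf q' \<subseteq> S"
    and pot: "\<And>a b. a \<in> S \<Longrightarrow> b \<in> S \<Longrightarrow> \<phi> b - \<phi> a \<le> dist a b powr p"
    and gap: "0 \<le> c" "c \<le> (\<integral>x. \<phi> x \<partial>measure_pmf q') - (\<integral>x. \<phi> x \<partial>measure_pmf q)"
  shows "c powr (1 / p) \<le> wasserstein_dist p (borel_law q) (borel_law q')"
proof -
  \<comment> \<open>\<open>\<phi>\<close> is arbitrary off \<open>S\<close>; cutting it off there makes it measurable.\<close>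
  define \<psi> where "\<psi> x = (\<Sum>s\<in>S. \<phi> s * indicator {s} x)" for x
  have \<psi>_eq: "\<psi> x = \<phi> x" if "x \<in> S" for x
  proof -
    have "\<psi> x = (\<Sum>s\<in>S. if s = x then \<phi> s else 0)"
      unfolding \<psi>_def by (intro sum.cong) (auto simp: indicator_def)
    then show ?thesis using that fin by simp
  qed
  have meas: "\<psi> \<in> borel_measurable borel"
    unfolding \<psi>_def by measurable
  have fq: "finite (set_pmf q)" "finite (set_pmf q')"
    using supp fin finite_subset by auto
  have W: "borel_law q \<in> wasserstein_space p" "borel_law q' \<in> wasserstein_space p"
    using fq by (auto intro: borel_law_in_wasserstein_space)
  have \<psi>_int: "(\<integral>x. \<psi> x \<partial>borel_law r) = (\<integral>x. \<phi> x \<partial>measure_pmf r)" if "set_pmf r \<subseteq> S" for r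
    unfolding integral_borel_law[OF meas]
    by (rule integral_cong_AE) (use that \<psi>_eq in \<open>auto simp: AE_measure_pmf_iff\<close>)
  show ?thesis
    unfolding wasserstein_dist_def
  proof (rule cINF_greatest)
    show "couplings (borel_law q) (borel_law q') \<noteq> {}"
      by (rule couplings_nonempty[OF W])
  next
    fix \<pi> assume \<pi>: "\<pi> \<in> couplings (borel_law q) (borel_law q')"
    then have sets [measurable_cong]: "sets \<pi> = sets borel"
      and m: "distr \<pi> borel fst = borel_law q" "distr \<pi> borel snd = borel_law q'"
      by (auto simp: couplings_def)
    have fm: "fst \<in> measurable \<pi> borel" "snd \<in> measurable \<pi> borel"
      by (auto simp: measurable_cong_sets[OF sets refl] measurable_fst_borel measurable_snd_borel)
    have closed: "{x \<in> space borel. x \<in> S} \<in> sets borel"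
      using fin by (auto simp: borel_closed finite_imp_closed)
    have "AE x in distr \<pi> borel fst. x \<in> S" "AE x in distr \<pi> borel snd. x \<in> S"
      unfolding m using AE_borel_law_support fin supp by auto
    then have ae: "AE z in \<pi>. fst z \<in> S" "AE z in \<pi>. snd z \<in> S"
      using AE_distr_iff[OF fm(1) closed] AE_distr_iff[OF fm(2) closed] by auto
    have "integrable (distr \<pi> borel fst) \<psi>" "integrable (distr \<pi> borel snd) \<psi>"
      unfolding m by (auto intro: integrable_borel_law_finite fq meas)
    then have int: "integrable \<pi> (\<lambda>z. \<psi> (fst z))" "integrable \<pi> (\<lambda>z. \<psi> (snd z))"
      using integrable_distr_eq[OF fm(1) meas] integrable_distr_eq[OF fm(2) meas] by auto
    have "(\<integral>z. \<psi> (fst z) \<partial>\<pi>) = (\<integral>x. \<phi> x \<partial>measure_pmf q)"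
         "(\<integral>z. \<psi> (snd z) \<partial>\<pi>) = (\<integral>x. \<phi> x \<partial>measure_pmf q')"
      using integral_distr[OF fm(1) meas] integral_distr[OF fm(2) meas] \<psi>_int supp
      unfolding m by auto
    then have "c \<le> (\<integral>z. \<psi> (snd z) - \<psi> (fst z) \<partial>\<pi>)"
      using gap(2) int by simp
    also have "\<dots> \<le> (\<integral>z. dist (fst z) (snd z) powr p \<partial>\<pi>)"
    proof (rule integral_mono_AE)
      show "integrable \<pi> (\<lambda>z. \<psi> (snd z) - \<psi> (fst z))" using int by simp
      show "integrable \<pi> (\<lambda>z. dist (fst z) (snd z) powr p)"
        using integrable_coupling_cost[OF W _ \<pi>] p by simp
      show "AE z in \<pi>. \<psi> (snd z) - \<psi> (fst z) \<le> dist (fst z) (snd z) powr p"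
        using ae by eventually_elim (simp add: \<psi>_eq pot)
    qed
    finally show "c powr (1 / p) \<le> (\<integral>z. dist (fst z) (snd z) powr p \<partial>\<pi>) powr (1 / p)"
      using gap(1) p by (intro powr_mono2) auto
  qed
qed

lemma integral_pmf_of_multiset:
  fixes f :: "'a \<Rightarrow> real"
  assumes "M \<noteq> {#}"
  shows "(\<integral>x. f x \<partial>measure_pmf (pmf_of_multiset M)) = (\<Sum>x\<in>#M. f x) / size M"
proof -
  have *: "(\<Sum>a\<in>S. f a * count M a) = (\<Sum>x\<in>#M. f x)" if "finite S" "set_mset M \<subseteq> S" for S
    using that
  proof (induction M)
    case (add y M)
    have "(\<Sum>a\<in>S. f a * count (add_mset y M) a) = (\<Sum>a\<in>S. f a * count M a + (if a = y then f a else 0))"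
      by (intro sum.cong) (auto simp: algebra_simps)
    then show ?case using add by (simp add: sum.distrib)
  qed auto
  have "(\<integral>x. f x \<partial>measure_pmf (pmf_of_multiset M)) = (\<Sum>a\<in>set_mset M. f a * pmf (pmf_of_multiset M) a)"
    by (rule integral_measure_pmf_real) (use assms in auto)
  also have "\<dots> = (\<Sum>a\<in>set_mset M. f a * count M a) / size M"
    using assms by (simp add: sum_divide_distrib)
  finally show ?thesis using *[of "set_mset M"] by simp
qed

lemma map_pmf_of_multiset:
  assumes "M \<noteq> {#}"
  shows "map_pmf f (pmf_of_multiset M) = pmf_of_multiset (image_mset f M)"
proof (rule pmf_eqI)
  fix y
  have "pmf (map_pmf f (pmf_of_multiset M)) y = (\<integral>x. indicator (f -` {y}) x \<partial>measure_pmf (pmf_of_multiset M))"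
    by (simp add: pmf_map)
  also have "\<dots> = (\<Sum>x\<in>#M. indicator (f -` {y}) x) / size M"
    by (rule integral_pmf_of_multiset[OF assms])
  also have "(\<Sum>x\<in>#M. indicator (f -` {y}) x) = real (count (image_mset f M) y)"
    by (induction M) (auto simp: indicator_def)
  finally show "pmf (map_pmf f (pmf_of_multiset M)) y = pmf (pmf_of_multiset (image_mset f M)) y"
    using assms by simp
qed

text \<open>
  All measures in the embedding share the uniform background \<open>Z\<close> and differ in a single extra atom. If
  \<open>a \<in> Z\<close>, the atom at \<open>a\<close> has double mass; this is why a multiset is used.
\<close>

definition marked_law :: "'a::polish_space set \<Rightarrow> 'a \<Rightarrow> 'a measure" where
  "marked_law Z a = borel_law (pmf_of_multiset (add_mset a (mset_set Z)))"

lemma marked_law_in_wasserstein_space: "marked_law Z a \<in> wasserstein_space p"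
  unfolding marked_law_def by (rule borel_law_in_wasserstein_space) simp

definition path_cost :: "real \<Rightarrow> 'a::metric_space list \<Rightarrow> real" where
  "path_cost p zs = (\<Sum>(a, b)\<leftarrow>zip (butlast zs) (tl zs). dist a b powr p)"

text \<open>
  The extra atom need not travel from \<open>x\<close> to \<open>y\<close> in one jump. It can take the place of the first background
  point of a path, which moves on to the place of the second one, and so forth: the background looks
  unchanged, and the total cost is the sum of the \<open>p\<close>-th powers of the steps. For \<open>p > 1\<close> this is much
  cheaper than one long jump.
\<close>

lemma wasserstein_dist_le_path_cost:
  fixes Z :: "'a::polish_space set"
  assumes fin: "finite Z" and zs: "distinct zs" "set zs \<subseteq> Z"
  shows "wasserstein_dist p (marked_law Z x) (marked_law Z y)
    \<le> (path_cost p (x # zs @ [y]) / Suc (card Z)) powr (1 / p)"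
proof -
  \<comment> \<open>The coupling is uniform on \<open>P\<close>: points off the path stay, those on the path advance by one step.\<close>
  define steps where "steps = zip (x # zs) (zs @ [y])"
  define P where "P = image_mset (\<lambda>z. (z, z)) (mset_set (Z - set zs)) + mset steps"
  have split: "mset_set (Z - set zs) + mset zs = mset_set Z"
    using fin zs by (simp add: mset_set_Diff mset_set_set[symmetric] subset_imp_msubset_mset_set)
  have "map fst steps = x # zs" "map snd steps = zs @ [y]"
    unfolding steps_def by simp_all
  then have "image_mset fst (mset steps) = add_mset x (mset zs)"
     "image_mset snd (mset steps) = add_mset y (mset zs)"
    by (metis mset_map mset.simps(2), metis mset_map mset_append mset.simps union_mset_add_mset_right add.right_neutral)
  then have marg: "image_mset fst P = add_mset x (mset_set Z)" "image_mset snd P = add_mset y (mset_set Z)"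
    unfolding P_def split[symmetric] by (simp_all add: image_mset.compositionality o_def)
  have P: "P \<noteq> {#}" "size P = Suc (card Z)"
    using arg_cong[OF marg(1), of size] by auto
  have "(\<Sum>z\<in>#P. dist (fst z) (snd z) powr p) = path_cost p (x # zs @ [y])"
    by (simp add: P_def image_mset.compositionality o_def path_cost_def steps_def case_prod_unfold
        butlast_append flip: sum_mset_sum_list)
  then show ?thesis
    using wasserstein_dist_le_coupling[of p "pmf_of_multiset P"] P
    by (simp add: marked_law_def map_pmf_of_multiset marg integral_pmf_of_multiset)
qed

lemma wasserstein_dist_ge_potential_gap:
  fixes Z :: "'a::polish_space set"
  assumes p: "0 < p" and fin: "finite Z"
    and pot: "\<And>a b. a \<in> insert x (insert y Z) \<Longrightarrow> b \<in> insert x (insert y Z) \<Longrightarrow> \<phi> b - \<phi> a \<le> dist a b powr p"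
    and gap: "\<phi> x \<le> \<phi> y"
  shows "((\<phi> y - \<phi> x) / Suc (card Z)) powr (1 / p) \<le>
    wasserstein_dist p (marked_law Z x) (marked_law Z y)"
  unfolding marked_law_def
proof (rule wasserstein_dist_ge_potential[OF p, where S = "insert x (insert y Z)" and \<phi> = \<phi>])
  show "(\<phi> y - \<phi> x) / real (Suc (card Z)) \<le>
     (\<integral>z. \<phi> z \<partial>measure_pmf (pmf_of_multiset (add_mset y (mset_set Z)))) -
     (\<integral>z. \<phi> z \<partial>measure_pmf (pmf_of_multiset (add_mset x (mset_set Z))))"
    by (simp add: integral_pmf_of_multiset flip: diff_divide_distrib)
qed (use fin pot gap in auto)

section \<open>Segments between points of the moment curve\<close>

text \<open>
  The points \<open>(t, t\<^sup>2, t\<^sup>3)\<close> are in general position: no four of them lie in a plane, so the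
  segments between them meet only in common endpoints. This is where dimension three enters.
\<close>

definition moment_curve :: "real \<Rightarrow> real ^ 3" where
  "moment_curve t = vector [t, t ^ 2, t ^ 3]"

definition segment_point :: "'a::real_vector \<Rightarrow> 'a \<Rightarrow> real \<Rightarrow> 'a" where
  "segment_point a b \<tau> = (1 - \<tau>) *\<^sub>R a + \<tau> *\<^sub>R b"

lemma segment_point_swap: "segment_point a b \<tau> = segment_point b a (1 - \<tau>)"
  by (simp add: segment_point_def)

lemma dist_segment_point:
  fixes a b :: "'a::real_normed_vector"
  shows "dist (segment_point a b \<tau>) (segment_point a b \<tau>') = \<bar>\<tau> - \<tau>'\<bar> * dist a b"
proof -
  have "segment_point a b \<tau> - segment_point a b \<tau>' = (\<tau> - \<tau>') *\<^sub>R (b - a)"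
    by (simp add: segment_point_def algebra_simps)
  then show ?thesis by (simp add: dist_norm norm_minus_commute)
qed

lemma inj_moment_curve: "inj moment_curve"
  by (rule injI) (metis moment_curve_def vector_3(1))

text \<open>
  A quantitative form of general position. An affine function on \<open>\<real>\<^sup>3\<close> restricted to the moment curve is
  a cubic polynomial. Take the one with roots \<open>j\<close>, \<open>k\<close>, \<open>l\<close>: it vanishes on the segment from \<open>k\<close> to \<open>l\<close>,
  whereas on the segment from \<open>i\<close> to \<open>j\<close> it is \<open>1 - \<tau>\<close> times its value at \<open>i\<close>, a nonzero integer. So a
  point that is close to the other segment carries little of the vertex \<open>i\<close>.
\<close>

lemma moment_weight_le_dist:
  fixes i j k l n :: nat
  assumes "i \<le> n" "j \<le> n" "k \<le> n" "l \<le> n" "i \<notin> {j, k, l}" and \<tau>: "\<tau> \<le> 1"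
  shows "1 - \<tau> \<le> (1 + 3 * n + 3 * n\<^sup>2) *
     dist (segment_point (moment_curve i) (moment_curve j) \<tau>)
          (segment_point (moment_curve k) (moment_curve l) \<sigma>)"
proof -
  \<comment> \<open>\<open>F\<close> is the linear part of the affine function that is \<open>(t - j) (t - k) (t - l)\<close> on the curve.\<close>
  define A B :: real where "A = real j + real k + real l" and "B = real j * real k + real k * real l + real l * real j"
  define F :: "real ^ 3 \<Rightarrow> real" where "F z = z $ 3 - A * z $ 2 + B * z $ 1" for z
  define z where "z = segment_point (moment_curve i) (moment_curve j) \<tau>"
  define w where "w = segment_point (moment_curve k) (moment_curve l) \<sigma>"
  define Q :: int where "Q = (int i - j) * (int i - k) * (int i - l)"
  have "F z - F w = (1 - \<tau>) * Q"
    unfolding F_def z_def w_def segment_point_def moment_curve_def A_def B_def Q_def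
    by (simp add: vector_3) (simp add: algebra_simps power2_eq_square power3_eq_cube)
  moreover have "Q \<noteq> 0" using assms unfolding Q_def by auto
  then have "1 \<le> \<bar>real_of_int Q\<bar>" by linarith
  ultimately have "1 - \<tau> \<le> \<bar>F z - F w\<bar>"
    using \<tau> mult_left_mono[of 1 "\<bar>real_of_int Q\<bar>" "1 - \<tau>"] by (simp add: abs_mult)
  also have "F z - F w = (z - w) $ 3 - A * (z - w) $ 2 + B * (z - w) $ 1"
    by (simp add: F_def algebra_simps)
  also have "\<bar>\<dots>\<bar> \<le> \<bar>(z - w) $ 3\<bar> + A * \<bar>(z - w) $ 2\<bar> + B * \<bar>(z - w) $ 1\<bar>"
  proof -
    have "0 \<le> A" "0 \<le> B" by (auto simp: A_def B_def)
    then have "\<bar>A * (z - w) $ 2\<bar> = A * \<bar>(z - w) $ 2\<bar>" "\<bar>B * (z - w) $ 1\<bar> = B * \<bar>(z - w) $ 1\<bar>"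
      by (simp_all add: abs_mult)
    then show ?thesis by linarith
  qed
  also have "\<dots> \<le> 1 * dist z w + (3 * n) * dist z w + (3 * n\<^sup>2) * dist z w"
  proof -
    have c: "\<bar>(z - w) $ m\<bar> \<le> dist z w" for m
      by (metis component_le_norm_cart dist_norm)
    have nn: "real j \<le> n" "real k \<le> n" "real l \<le> n" using assms by auto
    then have "B \<le> real n * real n + real n * real n + real n * real n"
      unfolding B_def by (intro add_mono mult_mono) auto
    then have "B \<le> 3 * n\<^sup>2" by (simp add: power2_eq_square)
    moreover have "A \<le> 3 * n" using nn by (simp add: A_def)
    ultimately show ?thesis
      using c by (intro add_mono mult_mono) auto
  qed
  finally show ?thesis unfolding z_def w_def by (simp add: algebra_simps)
qed

text \<open>
  Flat near both ends of the unit interval and symmetric about its midpoint, so that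
  \<open>ramp \<theta> (1 - t)\<close> and \<open>ramp \<theta> t\<close> can serve as weights of the two ends of a segment.
\<close>

definition ramp :: "real \<Rightarrow> real \<Rightarrow> real" where
  "ramp \<theta> t = max 0 (min 1 ((t - \<theta>) / (1 - 2 * \<theta>)))"

lemma ramp_bounds: "0 \<le> ramp \<theta> t" "ramp \<theta> t \<le> 1"
  by (auto simp: ramp_def)

lemma ramp_eq_0: "t \<le> \<theta> \<Longrightarrow> \<theta> < 1/2 \<Longrightarrow> ramp \<theta> t = 0"
  using divide_nonpos_pos[of "t - \<theta>" "1 - 2 * \<theta>"] by (simp add: ramp_def)

lemma ramp_compl: "\<theta> < 1/2 \<Longrightarrow> ramp \<theta> (1 - t) = 1 - ramp \<theta> t"
  by (auto simp: ramp_def max_def min_def field_simps)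

lemma ramp_lipschitz:
  assumes "\<theta> < 1/2"
  shows "\<bar>ramp \<theta> t - ramp \<theta> u\<bar> \<le> \<bar>t - u\<bar> / (1 - 2 * \<theta>)"
proof -
  have "\<bar>ramp \<theta> t - ramp \<theta> u\<bar> \<le> \<bar>(t - \<theta>) / (1 - 2 * \<theta>) - (u - \<theta>) / (1 - 2 * \<theta>)\<bar>"
    unfolding ramp_def by linarith
  also have "\<dots> = \<bar>t - u\<bar> / (1 - 2 * \<theta>)"
    using assms by (simp flip: diff_divide_distrib)
  finally show ?thesis .
qed

text \<open>
  Interpolates between the values \<open>a\<close> and \<open>b\<close> at the ends of a segment, but is constant near both ends.
  Segments with a common endpoint come arbitrarily close to each other there, and short jumps between
  them must not be allowed to change the value.
\<close>

definition edge_value :: "real \<Rightarrow> real \<Rightarrow> real \<Rightarrow> real \<Rightarrow> real" where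
  "edge_value \<theta> a b \<tau> = ramp \<theta> (1 - \<tau>) * a + ramp \<theta> \<tau> * b"

lemma edge_value_swap: "edge_value \<theta> a b \<tau> = edge_value \<theta> b a (1 - \<tau>)"
  by (simp add: edge_value_def)

lemma edge_value_ends:
  assumes "0 \<le> \<theta>" "\<theta> < 1/2"
  shows "edge_value \<theta> a b 0 = a" "edge_value \<theta> a b 1 = b"
  using assms ramp_eq_0[of 0 \<theta>] ramp_compl[of \<theta> 0] by (simp_all add: edge_value_def)

lemma edge_value_altdef: "\<theta> < 1/2 \<Longrightarrow> edge_value \<theta> a b \<tau> = a + ramp \<theta> \<tau> * (b - a)"
  by (simp add: edge_value_def ramp_compl algebra_simps)

lemma edge_value_bounds:
  assumes "\<theta> < 1/2" "0 \<le> a" "a \<le> M" "0 \<le> b" "b \<le> M"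
  shows "0 \<le> edge_value \<theta> a b \<tau>" "edge_value \<theta> a b \<tau> \<le> M"
proof -
  show "0 \<le> edge_value \<theta> a b \<tau>"
    using assms by (simp add: edge_value_def ramp_bounds)
  have "edge_value \<theta> a b \<tau> \<le> ramp \<theta> (1 - \<tau>) * M + ramp \<theta> \<tau> * M"
    unfolding edge_value_def using assms by (intro add_mono mult_left_mono ramp_bounds)
  also have "\<dots> = M" using assms by (simp add: ramp_compl algebra_simps)
  finally show "edge_value \<theta> a b \<tau> \<le> M" .
qed

lemma edge_value_lipschitz:
  assumes "\<theta> < 1/2"
  shows "\<bar>edge_value \<theta> a b \<tau> - edge_value \<theta> a b \<sigma>\<bar> \<le> \<bar>\<tau> - \<sigma>\<bar> * \<bar>b - a\<bar> / (1 - 2 * \<theta>)"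
proof -
  have "edge_value \<theta> a b \<tau> - edge_value \<theta> a b \<sigma> = (ramp \<theta> \<tau> - ramp \<theta> \<sigma>) * (b - a)"
    by (simp add: edge_value_altdef[OF assms] algebra_simps)
  then show ?thesis
    using mult_right_mono[OF ramp_lipschitz[OF assms], of "\<bar>b - a\<bar>" \<tau> \<sigma>] by (simp add: abs_mult)
qed

text \<open>
  A vertex that belongs to only one of two distinct segments has weight at most \<open>\<theta>\<close> at a place where the
  segments are close, so the ramp removes its contribution. Hence the segments have a common vertex, and
  both values are that of \<open>D\<close> there.
\<close>

lemma edge_value_eq_if_close:
  fixes i j k l n :: nat and D :: "nat \<Rightarrow> real"
  assumes le: "i \<le> n" "j \<le> n" "k \<le> n" "l \<le> n" and ne: "i \<noteq> j" "k \<noteq> l" "{i, j} \<noteq> {k, l}"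
    and \<theta>: "\<theta> < 1/2" and \<tau>: "\<tau> \<in> {0..1}" "\<sigma> \<in> {0..1}"
    and close: "(1 + 3 * n + 3 * n\<^sup>2) *
     dist (segment_point (moment_curve i) (moment_curve j) \<tau>)
          (segment_point (moment_curve k) (moment_curve l) \<sigma>) \<le> \<theta>"
  shows "edge_value \<theta> (D i) (D j) \<tau> = edge_value \<theta> (D k) (D l) \<sigma>"
proof -
  have gone: "ramp \<theta> (1 - \<tau>) = 0"
    if "i \<le> n" "j \<le> n" "k \<le> n" "l \<le> n" "i \<notin> {j, k, l}" "\<tau> \<in> {0..1}" and "(1 + 3 * n + 3 * n\<^sup>2) *
     dist (segment_point (moment_curve i) (moment_curve j) \<tau>)
          (segment_point (moment_curve k) (moment_curve l) \<sigma>) \<le> \<theta>"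
    for i j k l :: nat and \<tau> \<sigma>
    using moment_weight_le_dist[of i n j k l \<tau> \<sigma>] that \<theta> by (intro ramp_eq_0) auto
  have i: "ramp \<theta> (1 - \<tau>) = 0" if "i \<notin> {k, l}"
    using gone[of i j k l \<tau> \<sigma>] that assms by auto
  have j: "ramp \<theta> \<tau> = 0" if "j \<notin> {k, l}"
    using gone[of j i k l "1 - \<tau>" \<sigma>] that assms by (auto simp flip: segment_point_swap)
  have k: "ramp \<theta> (1 - \<sigma>) = 0" if "k \<notin> {i, j}"
    using gone[of k l i j \<sigma> \<tau>] that assms by (auto simp: dist_commute)
  have l: "ramp \<theta> \<sigma> = 0" if "l \<notin> {i, j}"
    using gone[of l k i j "1 - \<sigma>" \<tau>] that assms by (auto simp: dist_commute simp flip: segment_point_swap)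
  have *: "ramp \<theta> (1 - \<tau>) + ramp \<theta> \<tau> = 1" "ramp \<theta> (1 - \<sigma>) + ramp \<theta> \<sigma> = 1"
    by (simp_all add: ramp_compl[OF \<theta>])
  consider "i = k" "j \<noteq> l" | "i = l" "j \<noteq> k" | "j = k" "i \<noteq> l" | "j = l" "i \<noteq> k"
    | "i \<notin> {k, l}" "j \<notin> {k, l}"
    using ne by (auto simp: doubleton_eq_iff)
  then show ?thesis
  proof cases
    case 1
    then have "ramp \<theta> \<tau> = 0" "ramp \<theta> \<sigma> = 0" using j l ne by auto
    with \<open>i = k\<close> * show ?thesis by (simp add: edge_value_def)
  next
    case 2
    then have "ramp \<theta> \<tau> = 0" "ramp \<theta> (1 - \<sigma>) = 0" using j k ne by auto
    with \<open>i = l\<close> * show ?thesis by (simp add: edge_value_def)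
  next
    case 3
    then have "ramp \<theta> (1 - \<tau>) = 0" "ramp \<theta> \<sigma> = 0" using i l ne by auto
    with \<open>j = k\<close> * show ?thesis by (simp add: edge_value_def)
  next
    case 4
    then have "ramp \<theta> (1 - \<tau>) = 0" "ramp \<theta> (1 - \<sigma>) = 0" using i k ne by auto
    with \<open>j = l\<close> * show ?thesis by (simp add: edge_value_def)
  next
    case 5
    then show ?thesis using i j * by simp
  qed
qed

section \<open>Chains of equal steps\<close>

definition chain_cost :: "real \<Rightarrow> real \<Rightarrow> nat \<Rightarrow> real" where
  "chain_cost p L m = m * (L / m) powr p"

lemma chain_cost_eq: "m > 0 \<Longrightarrow> L > 0 \<Longrightarrow> chain_cost p L m = L powr p * real m powr (1 - p)"
  by (simp add: chain_cost_def powr_divide powr_diff field_simps)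

text \<open>
  The cost of a chain is proportional to \<open>m\<^bsup>1 - p\<^esup>\<close>: it tends to \<open>0\<close>, with ratios of consecutive terms
  tending to \<open>1\<close>. So every sufficiently small target is met up to the factor \<open>K\<close>, whatever the length of
  the segment is.
\<close>

lemma eventually_chain_cost_between:
  assumes p: "1 < p" and L: "0 < L" and D: "0 < D" and K: "1 < K"
  shows "\<forall>\<^sub>F s in at_right 0. \<exists>m>0. s * D \<le> chain_cost p L m \<and> chain_cost p L m \<le> K * (s * D)"
proof -
  have "((\<lambda>m::nat. (1 + 1 / real m) powr (p - 1)) \<longlongrightarrow> (1 + 0) powr (p - 1)) sequentially"
    by (intro tendsto_intros lim_1_over_n) auto
  then have "\<forall>\<^sub>F m in sequentially. (1 + 1 / real m) powr (p - 1) < K"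
    by (rule order_tendstoD) (use K in auto)
  then obtain N where N: "\<And>m. m \<ge> N \<Longrightarrow> (1 + 1 / real m) powr (p - 1) < K"
    by (auto simp: eventually_sequentially)
  define N' where "N' = Suc N"
  have lim: "chain_cost p L \<longlonglongrightarrow> 0"
  proof -
    have "(\<lambda>m. L powr p * real m powr (1 - p)) \<longlonglongrightarrow> L powr p * 0"
      using p by (intro tendsto_mult tendsto_const tendsto_neg_powr filterlim_real_sequentially) auto
    moreover have "\<forall>\<^sub>F m in sequentially. L powr p * real m powr (1 - p) = chain_cost p L m"
      using eventually_gt_at_top[of 0] by eventually_elim (simp add: chain_cost_eq L)
    ultimately show ?thesis by (simp add: tendsto_cong)
  qed
  have "\<forall>\<^sub>F s in at_right 0. s \<in> {0<..<chain_cost p L N' / D}"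
    by (rule eventually_at_right_real) (use D L in \<open>simp add: chain_cost_def N'_def\<close>)
  then show ?thesis
  proof eventually_elim
    case (elim s)
    \<comment> \<open>The last \<open>m\<close> whose cost is not below the target: one more step and the cost is too small.\<close>
    define S where "S = {m. m > 0 \<and> s * D \<le> chain_cost p L m}"
    have "\<forall>\<^sub>F m in sequentially. chain_cost p L m < s * D"
      by (rule order_tendstoD[OF lim]) (use elim D in auto)
    then obtain B where "\<And>m. m \<ge> B \<Longrightarrow> chain_cost p L m < s * D"
      by (auto simp: eventually_sequentially)
    then have "S \<subseteq> {..<B}" unfolding S_def by (force simp: not_less[symmetric])
    then have fin: "finite S" using finite_subset by blast
    have N'S: "N' \<in> S" using elim D by (auto simp: S_def N'_def field_simps)
    define m where "m = Max S"
    have m: "m \<in> S" "N' \<le> m"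
      unfolding m_def using fin N'S by (auto intro: Max_in)
    have m': "Suc m \<notin> S"
      using Max_ge[OF fin, of "Suc m"] by (auto simp: m_def)
    have "m > 0" "m \<ge> N" using m by (auto simp: S_def N'_def)
    have "chain_cost p L m = chain_cost p L (Suc m) * (1 + 1 / real m) powr (p - 1)"
    proof -
      have "1 + 1 / real m = real (Suc m) / real m" using \<open>m > 0\<close> by (simp add: field_simps)
      then have "(1 + 1 / real m) powr (p - 1) = real (Suc m) powr (p - 1) * real m powr (1 - p)"
        using \<open>m > 0\<close> by (simp add: powr_divide powr_minus_divide[of _ "p - 1", simplified])
      moreover have "real (Suc m) powr (1 - p) * real (Suc m) powr (p - 1) = 1"
        by (simp flip: powr_add)
      ultimately show ?thesis using \<open>m > 0\<close> L by (simp add: chain_cost_eq)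
    qed
    also have "\<dots> \<le> (s * D) * K"
      using m' N[OF \<open>m \<ge> N\<close>] elim D by (intro mult_mono) (auto simp: S_def)
    finally show ?case using m(1) by (auto simp: S_def mult.commute)
  qed
qed

text \<open>
  Jumping over \<open>t\<close> steps at once costs at least as much as making them one by one, since \<open>t\<^sup>p \<ge> t\<close>.
\<close>

lemma step_le_jump:
  assumes p: "1 \<le> p" and m: "0 < m" and c: "c \<le> chain_cost p L m" and t: "t \<in> \<nat>"
  shows "t / m * c \<le> (t / m * L) powr p"
proof (cases "t = 0")
  case False
  obtain k where k: "t = real k" using t by (auto elim: Nats_cases)
  have "t / m * c \<le> t / m * chain_cost p L m"
    using c k by (intro mult_left_mono) auto
  also have "\<dots> = t powr 1 * (L / m) powr p"
    using m k by (simp add: chain_cost_def)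
  also have "\<dots> \<le> t powr p * (L / m) powr p"
    using p False k by (intro mult_right_mono powr_mono) auto
  also have "\<dots> = (t / m * L) powr p"
    using k by (simp flip: powr_mult add: mult_ac)
  finally show ?thesis .
qed simp

lemma path_cost_map_upt:
  "path_cost p (map f [0..<Suc m]) = (\<Sum>t<m. dist (f t) (f (Suc t)) powr p)"
proof -
  have 1: "butlast (map f [0..<Suc m]) = map f [0..<m]" by simp
  have 2: "tl (map f [0..<Suc m]) = map (\<lambda>t. f (Suc t)) [0..<m]"
    by (rule nth_equalityI) (simp_all add: nth_tl del: upt_Suc)
  show ?thesis
    unfolding path_cost_def 1 2 zip_map_map
    by (simp add: zip_same_conv_map o_def interv_sum_list_conv_sum_set_nat atLeast0LessThan)
qed

lemma path_cost_segment:
  fixes a b :: "'a::real_normed_vector"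
  assumes "0 < m"
  shows "path_cost p (map (\<lambda>t. segment_point a b (t / m)) [0..<Suc m]) = chain_cost p (dist a b) m"
proof -
  have "dist (segment_point a b (t / m)) (segment_point a b (Suc t / m)) = dist a b / m" for t
  proof -
    have "real t / m - real (Suc t) / m = - (1 / m)"
      by (simp add: add_divide_distrib)
    then show ?thesis
      unfolding dist_segment_point by simp
  qed
  then show ?thesis
    using assms by (simp add: path_cost_map_upt chain_cost_def del: upt_Suc)
qed

lemma ex_chain_on_segment:
  fixes a b :: "'a::real_normed_vector"
  assumes "a \<noteq> b" "0 < m"
  shows "\<exists>zs. distinct zs \<and> set zs \<subseteq> (\<lambda>t::nat. segment_point a b (t / m)) ` {..m}
    \<and> path_cost p (a # zs @ [b]) = chain_cost p (dist a b) m"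
proof -
  define pos where "pos = (\<lambda>t::nat. segment_point a b (t / m))"
  have "inj pos"
  proof (rule injI)
    fix t u assume "pos t = pos u"
    then have "dist (pos t) (pos u) = 0" by simp
    then show "t = u" using assms by (simp add: pos_def dist_segment_point)
  qed
  then have "distinct (map pos [1..<m])" by (simp add: distinct_map inj_on_def)
  moreover have "set (map pos [1..<m]) \<subseteq> pos ` {..m}" by auto
  moreover have "[0..<Suc m] = 0 # [1..<m] @ [m]" using assms by (simp add: upt_conv_Cons)
  then have "a # map pos [1..<m] @ [b] = map pos [0..<Suc m]"
    using assms by (simp add: pos_def segment_point_def)
  then have "path_cost p (a # map pos [1..<m] @ [b]) = chain_cost p (dist a b) m"
    using path_cost_segment[OF assms(2), of p a b] by (simp add: pos_def del: upt_Suc)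
  ultimately show ?thesis unfolding pos_def by (intro exI conjI)
qed

text \<open>
  The ramp costs the factor \<open>1 - 2 * \<theta>\<close>: it has to make up for its plateaus by a steeper slope.
\<close>

lemma edge_value_jump_le:
  fixes v w :: "'a::real_normed_vector"
  assumes p: "1 \<le> p" and \<theta>: "\<theta> < 1/2" and m: "0 < m" and s: "0 \<le> s"
    and c: "s * d \<le> chain_cost p (dist v w) m" and ab: "\<bar>b - a\<bar> \<le> d"
  shows "s * (1 - 2 * \<theta>) * \<bar>edge_value \<theta> a b (real t / m) - edge_value \<theta> a b (real k / m)\<bar>
    \<le> dist (segment_point v w (t / m)) (segment_point v w (k / m)) powr p"
proof -
  define h where "h = \<bar>real t - real k\<bar>"
  have h: "h \<in> \<nat>"
  proof -
    have "h = real (if t \<le> k then k - t else t - k)" by (simp add: h_def of_nat_diff)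
    then show ?thesis by (simp only: of_nat_in_Nats)
  qed
  have hm: "\<bar>real t / m - real k / m\<bar> = h / m"
    using m by (simp add: h_def abs_divide flip: diff_divide_distrib)
  have "(1 - 2 * \<theta>) * \<bar>edge_value \<theta> a b (real t / m) - edge_value \<theta> a b (real k / m)\<bar> \<le> h / m * \<bar>b - a\<bar>"
    using edge_value_lipschitz[OF \<theta>, of a b "t / m" "k / m"] \<theta>
    unfolding hm by (subst (asm) pos_le_divide_eq) (auto simp: mult.commute)
  also have "\<dots> \<le> h / m * d"
    using ab by (intro mult_left_mono) (auto simp: h_def)
  finally have "s * ((1 - 2 * \<theta>) * \<bar>edge_value \<theta> a b (real t / m) - edge_value \<theta> a b (real k / m)\<bar>)
      \<le> s * (h / m * d)"
    using s by (intro mult_left_mono) auto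
  also have "\<dots> = h / m * (s * d)" by simp
  also have "\<dots> \<le> (h / m * dist v w) powr p"
    by (rule step_le_jump[OF p m c h])
  finally show ?thesis
    unfolding dist_segment_point hm by (simp add: mult.assoc)
qed

text \<open>
  Values that are given in terms of indices descend to the points, because the cost of not moving is \<open>0\<close>.
\<close>

lemma ex_potential_of_indexed_values:
  fixes pos :: "'i \<Rightarrow> 'b::metric_space" and val :: "'i \<Rightarrow> real"
  assumes lip: "\<And>i j. i \<in> I \<Longrightarrow> j \<in> I \<Longrightarrow> \<bar>val i - val j\<bar> \<le> dist (pos i) (pos j) powr p"
  obtains \<phi> where "\<And>i. i \<in> I \<Longrightarrow> \<phi> (pos i) = val i"
    and "\<And>a b. a \<in> pos ` I \<Longrightarrow> b \<in> pos ` I \<Longrightarrow> \<phi> b - \<phi> a \<le> dist a b powr p"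
proof -
  define \<phi> where "\<phi> z = val (SOME i. i \<in> I \<and> pos i = z)" for z
  have \<phi>: "\<phi> (pos i) = val i" if "i \<in> I" for i
  proof -
    define j where "j = (SOME j. j \<in> I \<and> pos j = pos i)"
    have "j \<in> I \<and> pos j = pos i" unfolding j_def by (rule someI[of _ i]) (use that in simp)
    then have "val j = val i" using lip[of j i] that by simp
    then show ?thesis by (simp add: \<phi>_def j_def)
  qed
  have "\<phi> b - \<phi> a \<le> dist a b powr p" if ab: "a \<in> pos ` I" "b \<in> pos ` I" for a b
  proof -
    obtain i j where ij: "i \<in> I" "j \<in> I" "a = pos i" "b = pos j" using ab by blast
    then show ?thesis using lip[of i j] by (simp add: \<phi>)
  qed
  with \<phi> show thesis by (rule that)
qed

section \<open>Realising a finite metric by chains\<close>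

text \<open>
  The background consists of the division points of all segments between the points \<open>v x\<close> on the moment
  curve; the number of steps from \<open>v x\<close> to \<open>v y\<close> is chosen such that the chain costs about \<open>s * d x y\<close>.
  Going along the segment gives the cheap path. For the potential, fix \<open>x\<close> and interpolate the function
  \<open>u \<mapsto> d x u\<close> along the segments. A jump within one segment changes the potential by no more than its
  cost, by the triangle inequality in \<open>X\<close>. A jump between different segments either does not change the
  potential or has a length bounded below, uniformly in \<open>s\<close>; so it is expensive enough when \<open>s\<close> is small.
\<close>

lemma ex_chain_background_in_R3:
  fixes X :: "'a set" and d :: "'a \<Rightarrow> 'a \<Rightarrow> real"
  assumes met: "Metric_space X d" and fin: "finite X" and p: "1 < p" and K: "1 < K"
  obtains v :: "'a \<Rightarrow> real ^ 3" and Z r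
  where "finite Z" "0 < r"
    and "\<And>x y. x \<in> X \<Longrightarrow> y \<in> X \<Longrightarrow> x \<noteq> y \<Longrightarrow>
      \<exists>zs. distinct zs \<and> set zs \<subseteq> Z \<and> path_cost p (v x # zs @ [v y]) \<le> K * (r * d x y)"
    and "\<And>x y. x \<in> X \<Longrightarrow> y \<in> X \<Longrightarrow>
      \<exists>\<phi>. (\<forall>a \<in> insert (v x) (insert (v y) Z). \<forall>b \<in> insert (v x) (insert (v y) Z). \<phi> b - \<phi> a \<le> dist a b powr p)
         \<and> \<phi> (v y) - \<phi> (v x) = r * d x y"
proof -
  interpret Metric_space X d by (rule met)
  obtain f :: "'a \<Rightarrow> nat" where f: "inj_on f X"
    using finite_imp_inj_to_nat_seg[OF fin] by blast
  define v :: "'a \<Rightarrow> real ^ 3" where "v x = moment_curve (f x)" for x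
  have vne: "v x \<noteq> v y" if "x \<in> X" "y \<in> X" "x \<noteq> y" for x y
    using that f by (auto simp: v_def inj_eq[OF inj_moment_curve] inj_on_eq_iff)
  define n where "n = Max (insert 0 (f ` X))"
  have fn: "f x \<le> n" if "x \<in> X" for x
    using that fin by (auto simp: n_def intro!: Max_ge)
  define C where "C = real (1 + 3 * n + 3 * n\<^sup>2)"
  have C: "0 < C" unfolding C_def by (subst of_nat_0_less_iff) simp
  \<comment> \<open>One factor \<open>sqrt K\<close> is spent on rounding the number of steps, the other one on the plateaus.\<close>
  define K' where "K' = sqrt K"
  have K': "1 < K'" "K' * K' = K" using K by (auto simp: K'_def)
  define \<theta> where "\<theta> = (1 - 1 / K') / 2"
  have \<theta>: "0 < \<theta>" "\<theta> < 1/2" "1 - 2 * \<theta> = 1 / K'" using K'(1) by (auto simp: \<theta>_def field_simps)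
  define \<Delta> where "\<Delta> = Max (insert 1 ((\<lambda>(x, y). d x y) ` (X \<times> X)))"
  have \<Delta>: "d x y \<le> \<Delta>" if "x \<in> X" "y \<in> X" for x y
    unfolding \<Delta>_def using that fin by (intro Max_ge) auto
  have \<Delta>1: "1 \<le> \<Delta>" unfolding \<Delta>_def using fin by (intro Max_ge) auto
  define E where "E = {(x, y). x \<in> X \<and> y \<in> X \<and> x \<noteq> y}"
  define good where "good s L D m \<longleftrightarrow> 0 < m \<and> s * D \<le> chain_cost p L m \<and> chain_cost p L m \<le> K' * (s * D)"
    for s L D m
  have finE: "finite E" unfolding E_def by (rule finite_subset[of _ "X \<times> X"]) (use fin in auto)
  have "\<forall>\<^sub>F s in at_right 0. \<forall>(x, y)\<in>E. \<exists>m. good s (dist (v x) (v y)) (d x y) m"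
  proof (intro eventually_ball_finite finE ballI, clarify)
    fix x y assume "(x, y) \<in> E"
    then have xy: "x \<in> X" "y \<in> X" "x \<noteq> y" by (auto simp: E_def)
    then have "0 < dist (v x) (v y)" "0 < d x y" using vne by auto
    from eventually_chain_cost_between[OF p this K'(1)]
    show "\<forall>\<^sub>F s in at_right 0. \<exists>m. good s (dist (v x) (v y)) (d x y) m"
      by (simp add: good_def)
  qed
  moreover have "\<forall>\<^sub>F s in at_right 0. s \<in> {0<..<(\<theta> / C) powr p / \<Delta>}"
    by (rule eventually_at_right_real) (use \<theta> C \<Delta>1 in auto)
  ultimately have "\<forall>\<^sub>F s in at_right 0. s \<in> {0<..<(\<theta> / C) powr p / \<Delta>} \<and>
      (\<forall>(x, y)\<in>E. \<exists>m. good s (dist (v x) (v y)) (d x y) m)"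
    by eventually_elim auto
  then obtain s where "s \<in> {0<..<(\<theta> / C) powr p / \<Delta>}"
    and ex: "\<forall>(x, y)\<in>E. \<exists>m. good s (dist (v x) (v y)) (d x y) m"
    using eventually_happens'[OF trivial_limit_at_right_real] by blast
  then have s: "0 < s" "s * \<Delta> \<le> (\<theta> / C) powr p"
    using \<Delta>1 by (simp_all add: pos_less_divide_eq)
  \<comment> \<open>A function of the length and of the distance only, so that both directions of a segment are divided
    in the same way.\<close>
  define steps where "steps x y = (SOME m. good s (dist (v x) (v y)) (d x y) m)" for x y
  have steps: "good s (dist (v x) (v y)) (d x y) (steps x y)" if "x \<in> X" "y \<in> X" "x \<noteq> y" for x y
    unfolding steps_def by (rule someI_ex) (use ex that in \<open>auto simp: E_def\<close>)
  have steps_commute: "steps x y = steps y x" for x y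
    by (simp add: steps_def commute dist_commute)
  define pos where "pos = (\<lambda>(x, y, t::nat). segment_point (v x) (v y) (t / steps x y))"
  define I where "I = {(x, y, t). x \<in> X \<and> y \<in> X \<and> x \<noteq> y \<and> t \<le> steps x y}"
  define r where "r = s / K'"
  have r: "0 < r" "r \<le> s"
    using s(1) K'(1) mult_left_mono[of 1 K' s] by (simp_all add: r_def pos_divide_le_eq)
  have finI: "finite I"
  proof (rule finite_subset)
    show "I \<subseteq> (\<lambda>((x, y), t). (x, y, t)) ` (SIGMA (x, y):E. {..steps x y})"
      by (force simp: I_def E_def)
  qed (use finE in auto)
  have pos_ends: "pos (x, y, 0) = v x" "x \<in> X \<Longrightarrow> y \<in> X \<Longrightarrow> x \<noteq> y \<Longrightarrow> pos (x, y, steps x y) = v y" for x y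
    using steps[of x y] by (auto simp: pos_def segment_point_def good_def)
  have "\<exists>zs. distinct zs \<and> set zs \<subseteq> pos ` I \<and> path_cost p (v x # zs @ [v y]) \<le> K * (r * d x y)"
    if xy: "x \<in> X" "y \<in> X" "x \<noteq> y" for x y
  proof -
    have m: "0 < steps x y" "chain_cost p (dist (v x) (v y)) (steps x y) \<le> K' * (s * d x y)"
      using steps[OF xy] by (auto simp: good_def)
    obtain zs where zs: "distinct zs" "path_cost p (v x # zs @ [v y]) = chain_cost p (dist (v x) (v y)) (steps x y)"
        "set zs \<subseteq> (\<lambda>t::nat. segment_point (v x) (v y) (t / steps x y)) ` {..steps x y}"
      using ex_chain_on_segment[OF vne[OF xy] m(1), of p] by blast
    have "segment_point (v x) (v y) (t / steps x y) \<in> pos ` I" if "t \<le> steps x y" for t :: nat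
      using that xy by (intro image_eqI[of _ _ "(x, y, t)"]) (simp_all add: pos_def I_def)
    then have "set zs \<subseteq> pos ` I" using zs(3) by auto
    moreover have "K' * (s * d x y) = K * (r * d x y)"
      using K'(1) unfolding K'(2)[symmetric] r_def by simp
    then have "path_cost p (v x # zs @ [v y]) \<le> K * (r * d x y)"
      using m(2) unfolding zs(2) by (rule subst)
    ultimately show ?thesis using zs(1) by (intro exI[of _ zs] conjI)
  qed
  moreover have "\<exists>\<phi>. (\<forall>a \<in> insert (v x) (insert (v y) (pos ` I)). \<forall>b \<in> insert (v x) (insert (v y) (pos ` I)).
           \<phi> b - \<phi> a \<le> dist a b powr p) \<and> \<phi> (v y) - \<phi> (v x) = r * d x y"
    if xy: "x \<in> X" "y \<in> X" for x y
  proof (cases "x = y")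
    case True
    then show ?thesis using xy by (intro exI[of _ "\<lambda>_. 0"]) auto
  next
    case False
    define val where "val = (\<lambda>(u, w, t). edge_value \<theta> (d x u) (d x w) (real t / steps u w))"
    have lip: "r * \<bar>val i - val j\<bar> \<le> dist (pos i) (pos j) powr p" if "i \<in> I" "j \<in> I" for i j
    proof -
      obtain u w t u' w' t' where ij: "i = (u, w, t)" "j = (u', w', t')" by (metis prod_cases3)
      have mem: "u \<in> X" "w \<in> X" "u \<noteq> w" "t \<le> steps u w" "u' \<in> X" "w' \<in> X" "u' \<noteq> w'" "t' \<le> steps u' w'"
        using that by (auto simp: ij I_def)
      \<comment> \<open>From distance \<open>\<theta> / C\<close> on, a jump costs more than any change of the potential; below it, distinct
        segments have equal values.\<close>
      show ?thesis
      proof (cases "\<theta> \<le> C * dist (pos i) (pos j)")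
        case True
        have "0 \<le> val i" "val i \<le> \<Delta>" "0 \<le> val j" "val j \<le> \<Delta>"
          using edge_value_bounds[OF \<theta>(2) nonneg \<Delta> nonneg \<Delta>, of x u x w "t / steps u w"]
            edge_value_bounds[OF \<theta>(2) nonneg \<Delta> nonneg \<Delta>, of x u' x w' "t' / steps u' w'"]
            xy mem by (simp_all add: ij val_def)
        then have "r * \<bar>val i - val j\<bar> \<le> s * \<Delta>"
          using r s(1) by (intro mult_mono) auto
        also have "\<dots> \<le> (\<theta> / C) powr p" by (rule s(2))
        also have "\<dots> \<le> dist (pos i) (pos j) powr p"
          using True \<theta>(1) C p by (intro powr_mono2) (auto simp: pos_divide_le_eq mult.commute)
        finally show ?thesis .
      next
        case close: False
        show ?thesis
        proof (cases "{u, w} = {u', w'}")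
          case False
          then have "{f u, f w} \<noteq> {f u', f w'}"
            using inj_on_image_eq_iff[OF f, of "{u, w}" "{u', w'}"] mem by simp
          moreover have "f u \<noteq> f w" "f u' \<noteq> f w'"
            using mem by (simp_all add: inj_on_eq_iff[OF f])
          moreover have "real t / steps u w \<in> {0..1}" "real t' / steps u' w' \<in> {0..1}"
            using mem steps[of u w] steps[of u' w'] by (simp_all add: good_def)
          moreover have "(1 + 3 * n + 3 * n\<^sup>2) *
              dist (segment_point (moment_curve (f u)) (moment_curve (f w)) (t / steps u w))
                (segment_point (moment_curve (f u')) (moment_curve (f w')) (t' / steps u' w')) \<le> \<theta>"
            using close unfolding ij pos_def v_def C_def prod.case by linarith
          ultimately have "edge_value \<theta> (D (f u)) (D (f w)) (t / steps u w)
              = edge_value \<theta> (D (f u')) (D (f w')) (t' / steps u' w')" for D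
            using mem by (intro edge_value_eq_if_close[OF fn fn fn fn _ _ _ \<theta>(2)])
          from this[of "\<lambda>k. d x (inv_into X f k)"] have "val i = val j"
            using mem by (simp add: ij val_def inv_into_f_f[OF f])
          then show ?thesis by simp
        next
          case True
          define m where "m = steps u w"
          have m: "0 < m" "s * d u w \<le> chain_cost p (dist (v u) (v w)) m"
            using steps[of u w] mem by (auto simp: good_def m_def)
          \<comment> \<open>If \<open>j\<close> runs through the segment in the opposite direction, count its steps from the other end.\<close>
          obtain k :: nat where k: "k \<le> m" "pos j = segment_point (v u) (v w) (k / m)"
             "val j = edge_value \<theta> (d x u) (d x w) (k / m)"
          proof (cases "u' = u")
            case True
            then have "w' = w" using \<open>{u, w} = {u', w'}\<close> by (auto simp: doubleton_eq_iff)
            then show ?thesis using that[of t'] mem True by (simp add: ij val_def pos_def m_def)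
          next
            case False
            then have uw: "u' = w" "w' = u" using True by (auto simp: doubleton_eq_iff)
            then have t': "t' \<le> m" "steps u' w' = m" using mem steps_commute by (auto simp: m_def)
            then have "1 - real t' / m = real (m - t') / m" using m(1) by (simp add: field_simps of_nat_diff)
            then show ?thesis
              using that[of "m - t'"] t' uw segment_point_swap[of "v w" "v u"] edge_value_swap[of \<theta> "d x w" "d x u"]
              by (simp add: ij val_def pos_def)
          qed
          have "\<bar>d x w - d x u\<bar> \<le> d u w"
            using mdist_reverse_triangle[of u x w] commute[of u x] xy mem by linarith
          from edge_value_jump_le[OF less_imp_le[OF p] \<theta>(2) m(1) _ m(2) this, of t k]
          have "s * (1 - 2 * \<theta>) * \<bar>val i - val j\<bar> \<le> dist (pos i) (pos j) powr p"
            using s(1) unfolding k(2,3) by (simp add: ij val_def pos_def m_def)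
          then show ?thesis unfolding \<theta>(3) r_def by simp
        qed
      qed
    qed
    have lip': "\<bar>r * val i - r * val j\<bar> \<le> dist (pos i) (pos j) powr p" if "i \<in> I" "j \<in> I" for i j
      using lip[OF that] r by (simp add: abs_mult flip: right_diff_distrib)
    obtain \<phi> where \<phi>: "\<And>i. i \<in> I \<Longrightarrow> \<phi> (pos i) = r * val i"
      and pot: "\<And>a b. a \<in> pos ` I \<Longrightarrow> b \<in> pos ` I \<Longrightarrow> \<phi> b - \<phi> a \<le> dist a b powr p"
      by (rule ex_potential_of_indexed_values[where val = "\<lambda>i. r * val i", OF lip']) (assumption+, rule that)
    have ends: "(x, y, 0) \<in> I" "(x, y, steps x y) \<in> I" using xy False by (auto simp: I_def)
    have vI: "v x = pos (x, y, 0)" "v y = pos (x, y, steps x y)" using pos_ends xy False by simp_all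
    have "\<phi> (v y) - \<phi> (v x) = r * d x y"
      unfolding vI \<phi>[OF ends(1)] \<phi>[OF ends(2)]
      using edge_value_ends[of \<theta>] \<theta> steps[OF xy False] xy by (simp add: val_def good_def)
    moreover have "insert (v x) (insert (v y) (pos ` I)) = pos ` I"
      using ends unfolding vI by auto
    ultimately show ?thesis using pot by (intro exI[of _ \<phi>]) simp
  qed
  ultimately show thesis
    using that[of "pos ` I" r v] finI r by simp
qed

section \<open>The embedding\<close>

text \<open>
  The \<open>p\<close>-th power of the Wasserstein distance of two marked laws is between \<open>r * dX x y\<close> and
  \<open>K * (r * dX x y)\<close>, up to the mass \<open>1 / Suc (card Z)\<close> of an atom. Taking roots turns this into distortion
  \<open>K\<^bsup>1 / p\<^esup> \<le> K\<close> for the snowflake.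
\<close>

lemma ex_snowflake_embedding:
  fixes X :: "'a set" and dX :: "'a \<Rightarrow> 'a \<Rightarrow> real"
  assumes p: "1 < p" and met: "Metric_space X dX" and fin: "finite X" and K: "1 < K"
  shows "\<exists>F. F \<in> X \<rightarrow> (wasserstein_space p :: (real^3) measure set) \<and>
    distortion_at_most X (\<lambda>x y. dX x y powr (1 / p)) (wasserstein_dist p) F (ereal K)"
proof -
  interpret Metric_space X dX by (rule met)
  obtain v :: "'a \<Rightarrow> real ^ 3" and Z r where Z: "finite Z" and r: "0 < r"
    and path: "\<And>x y. x \<in> X \<Longrightarrow> y \<in> X \<Longrightarrow> x \<noteq> y \<Longrightarrow>
       \<exists>zs. distinct zs \<and> set zs \<subseteq> Z \<and> path_cost p (v x # zs @ [v y]) \<le> K * (r * dX x y)"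
    and pot: "\<And>x y. x \<in> X \<Longrightarrow> y \<in> X \<Longrightarrow>
       \<exists>\<phi>. (\<forall>a \<in> insert (v x) (insert (v y) Z). \<forall>b \<in> insert (v x) (insert (v y) Z).
          \<phi> b - \<phi> a \<le> dist a b powr p) \<and> \<phi> (v y) - \<phi> (v x) = r * dX x y"
    by (rule ex_chain_background_in_R3[OF met fin p K]) (rule that)
  define F where "F x = marked_law Z (v x)" for x
  define s where "s = (r / Suc (card Z)) powr (1 / p)"
  have s: "0 < s" using r by (simp add: s_def)
  have s_mult: "(c * (r * dX x y) / Suc (card Z)) powr (1 / p) = c powr (1 / p) * (s * dX x y powr (1 / p))"
    if "0 \<le> c" for c x y
    using that r unfolding s_def by (simp add: powr_mult powr_divide)
  have lower: "s * dX x y powr (1 / p) \<le> wasserstein_dist p (F x) (F y)" if xy: "x \<in> X" "y \<in> X" for x y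
  proof -
    obtain \<phi> where \<phi>: "\<And>a b. a \<in> insert (v x) (insert (v y) Z) \<Longrightarrow> b \<in> insert (v x) (insert (v y) Z)
         \<Longrightarrow> \<phi> b - \<phi> a \<le> dist a b powr p" "\<phi> (v y) - \<phi> (v x) = r * dX x y"
      using pot[OF xy] by blast
    have "((\<phi> (v y) - \<phi> (v x)) / Suc (card Z)) powr (1 / p) \<le> wasserstein_dist p (F x) (F y)"
      unfolding F_def
    proof (rule wasserstein_dist_ge_potential_gap)
      have "0 \<le> r * dX x y" using r by simp
      then show "\<phi> (v x) \<le> \<phi> (v y)" using \<phi>(2) by linarith
    qed (use p Z \<phi>(1) in auto)
    then show ?thesis using s_mult[of 1 x y] by (simp add: \<phi>(2))
  qed
  have upper: "wasserstein_dist p (F x) (F y) \<le> K * (s * dX x y powr (1 / p))"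
    if xy: "x \<in> X" "y \<in> X" for x y
  proof -
    have "\<exists>zs. distinct zs \<and> set zs \<subseteq> Z \<and> path_cost p (v x # zs @ [v y]) \<le> K * (r * dX x y)"
    proof (cases "x = y")
      case True
      then show ?thesis using xy by (intro exI[of _ "[]"]) (simp add: path_cost_def)
    qed (use path xy in blast)
    then obtain zs where zs: "distinct zs" "set zs \<subseteq> Z" "path_cost p (v x # zs @ [v y]) \<le> K * (r * dX x y)"
      by blast
    have "wasserstein_dist p (F x) (F y) \<le> (path_cost p (v x # zs @ [v y]) / Suc (card Z)) powr (1 / p)"
      unfolding F_def by (rule wasserstein_dist_le_path_cost[OF Z zs(1,2)])
    also have "\<dots> \<le> (K * (r * dX x y) / Suc (card Z)) powr (1 / p)"
    proof (rule powr_mono2)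
      show "0 \<le> path_cost p (v x # zs @ [v y]) / Suc (card Z)"
        unfolding path_cost_def by (intro divide_nonneg_nonneg sum_list_nonneg) auto
    qed (use p zs(3) in \<open>auto intro: divide_right_mono\<close>)
    also have "\<dots> = K powr (1 / p) * (s * dX x y powr (1 / p))" using s_mult K by simp
    also have "\<dots> \<le> K * (s * dX x y powr (1 / p))"
    proof -
      have "K powr (1 / p) \<le> K powr 1" using K p by (intro powr_mono) auto
      then show ?thesis using K s by (intro mult_right_mono) auto
    qed
    finally show ?thesis .
  qed
  have "distortion_at_most X (\<lambda>x y. dX x y powr (1 / p)) (wasserstein_dist p) F (ereal K)"
    unfolding distortion_at_most_def using s lower upper by (intro exI[of _ s]) simp
  then show ?thesis
    by (intro exI[of _ F]) (simp add: F_def marked_law_in_wasserstein_space)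
qed

theorem theorem1:
  fixes p :: real and X :: "'a set" and dX :: "'a \<Rightarrow> 'a \<Rightarrow> real"
  assumes "1 < p"
    and "Metric_space X dX" and "finite X" and "X \<noteq> {}"
  shows "least_distortion (wasserstein_space p :: (real^3) measure set) (wasserstein_dist p)
           X (\<lambda>x y. dX x y powr (1 / p)) = 1"
proof (rule antisym)
  show "1 \<le> least_distortion (wasserstein_space p :: (real^3) measure set) (wasserstein_dist p)
           X (\<lambda>x y. dX x y powr (1 / p))"
    unfolding least_distortion_def by (rule Inf_greatest) auto
next
  show "least_distortion (wasserstein_space p :: (real^3) measure set) (wasserstein_dist p)
           X (\<lambda>x y. dX x y powr (1 / p)) \<le> 1"
  proof (rule ereal_le_epsilon2)
    fix e :: real assume e: "0 < e"
    obtain F where "F \<in> X \<rightarrow> (wasserstein_space p :: (real^3) measure set)"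
      and "distortion_at_most X (\<lambda>x y. dX x y powr (1 / p)) (wasserstein_dist p) F (ereal (1 + e))"
      using ex_snowflake_embedding[OF assms(1-3), of "1 + e"] e by auto
    then have "least_distortion (wasserstein_space p :: (real^3) measure set) (wasserstein_dist p)
           X (\<lambda>x y. dX x y powr (1 / p)) \<le> ereal (1 + e)"
      unfolding least_distortion_def using e
      by (intro Inf_lower CollectI conjI exI[of _ F]) (auto simp: one_ereal_def)
    then show "least_distortion (wasserstein_space p :: (real^3) measure set) (wasserstein_dist p)
           X (\<lambda>x y. dX x y powr (1 / p)) \<le> 1 + ereal e"
      by (simp add: one_ereal_def)
  qed
qed

end
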